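(* Let $(X,M,N,*,\diamond)$ be a complete intuitionistic fuzzy metric space and let $A\subseteq X$ be a non-empty $G_\delta$ subset of $X$ with respect to $\tau_{(M,N)}$. Then $A$, with the subspace topology, is a topologically complete intuitionistic fuzzy metrizable space.
   Context: A continuous t-norm is a binary operation $*:[0,1]\times[0,1]\to[0,1]$ that is associative, commutative, continuous, satisfies $a*1=a$ for all $a\in[0,1]$, and satisfies $a*b\le c*d$ whenever $a\le c$ and $b\le d$. A continuous t-conorm is a binary operation $\diamond:[0,1]\times[0,1]\to[0,1]$ that is associative, commutative, continuous, satisfies $a\diamond 0=a$ for all $a\in[0,1]$, and satisfies $a\diamond b\le c\diamond d$ whenever $a\le c$ and $b\le d$. An intuitionistic fuzzy metric space is a 5-tuple $(X,M,N,*,\diamond)$ where $X$ is a non-empty set, $*$ is a continuous t-norm, $\diamond$ is a continuous t-conorm, and $M,N:X\times X\times(0,\infty)\to[0,1]$ satisfy, for all $x,y,z\in X$ and $t,s>0$: (a) $M(x,y,t)+N(x,y,t)\le 1$; (b) $M(x,y,t)>0$; (c) $M(x,y,t)=1$ if and only if $x=y$; (d) $M(x,y,t)=M(y,x,t)$; (e) $M(x,y,t)*M(y,z,s)\le M(x,z,t+s)$; (f) $M(x,y,\cdot):(0,\infty)\to[0,1]$ is continuous; (g) $N(x,y,t)<1$; (h) $N(x,y,t)=0$ if and only if $x=y$; (i) $N(x,y,t)=N(y,x,t)$; (j) $N(x,y,t)\diamond N(y,z,s)\ge N(x,z,t+s)$; (k) $N(x,y,\cdot):(0,\infty)\to[0,1]$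 is continuous. Then $(M,N)$ is called an intuitionistic fuzzy metric on $X$. For $x\in X$, $0<r<1$, $t>0$, put $B(x,r,t)=\{y\in X: M(x,y,t)>1-r,\ N(x,y,t)<r\}$. The topology $\tau_{(M,N)}$ induced by $(M,N)$ consists of all $U\subseteq X$ such that for each $x\in U$ there exist $t>0$ and $0<r<1$ with $B(x,r,t)\subseteq U$. A sequence $\{x_n\}$ converges to $x$ if and only if $M(x_n,x,t)\to1$ and $N(x_n,x,t)\to0$ for each $t>0$. It is Cauchy if for each $0<\varepsilon<1$ and $t>0$ there is $n_0\in\mathbb{N}$ with $M(x_n,x_m,t)>1-\varepsilon$ and $N(x_n,x_m,t)<\varepsilon$ for all $n,m\ge n_0$. The space (and the intuitionistic fuzzy metric) is complete if every Cauchy sequence converges in it. A topological space is a topologically complete intuitionistic fuzzy metrizable space if there exists a complete intuitionistic fuzzy metric (with some continuous t-norm and t-conorm) inducing its topology. A $G_\delta$ set is a countable intersection of open sets. *)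

theory Defs
  imports "HOL-Analysis.Analysis"
begin

(* All operations are total in HOL; the axioms below constrain them only on the unit interval,
   on the carrier X and at times t > 0. *)

locale continuous_t_norm =
  fixes tnorm :: "real \<Rightarrow> real \<Rightarrow> real" (infixl "\<star>" 70)
  assumes closed: "\<lbrakk>a \<in> {0..1}; b \<in> {0..1}\<rbrakk> \<Longrightarrow> a \<star> b \<in> {0..1}"
    and assoc: "\<lbrakk>a \<in> {0..1}; b \<in> {0..1}; c \<in> {0..1}\<rbrakk> \<Longrightarrow> (a \<star> b) \<star> c = a \<star> (b \<star> c)"
    and commute: "\<lbrakk>a \<in> {0..1}; b \<in> {0..1}\<rbrakk> \<Longrightarrow> a \<star> b = b \<star> a"
    and continuous: "continuous_on ({0..1} \<times> {0..1}) (\<lambda>(a, b). a \<star> b)"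
    and unit: "a \<in> {0..1} \<Longrightarrow> a \<star> 1 = a"
    and mono: "\<lbrakk>a \<in> {0..1}; b \<in> {0..1}; c \<in> {0..1}; d \<in> {0..1}; a \<le> c; b \<le> d\<rbrakk>
                \<Longrightarrow> a \<star> b \<le> c \<star> d"

locale continuous_t_conorm =
  fixes tconorm :: "real \<Rightarrow> real \<Rightarrow> real" (infixl "\<diamondop>" 70)
  assumes closed: "\<lbrakk>a \<in> {0..1}; b \<in> {0..1}\<rbrakk> \<Longrightarrow> a \<diamondop> b \<in> {0..1}"
    and assoc: "\<lbrakk>a \<in> {0..1}; b \<in> {0..1}; c \<in> {0..1}\<rbrakk> \<Longrightarrow> (a \<diamondop> b) \<diamondop> c = a \<diamondop> (b \<diamondop> c)"
    and commute: "\<lbrakk>a \<in> {0..1}; b \<in> {0..1}\<rbrakk> \<Longrightarrow> a \<diamondop> b = b \<diamondop> a"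
    and continuous: "continuous_on ({0..1} \<times> {0..1}) (\<lambda>(a, b). a \<diamondop> b)"
    and unit: "a \<in> {0..1} \<Longrightarrow> a \<diamondop> 0 = a"
    and mono: "\<lbrakk>a \<in> {0..1}; b \<in> {0..1}; c \<in> {0..1}; d \<in> {0..1}; a \<le> c; b \<le> d\<rbrakk>
                \<Longrightarrow> a \<diamondop> b \<le> c \<diamondop> d"

locale intuitionistic_fuzzy_metric_space =
  tn: continuous_t_norm tnorm + tc: continuous_t_conorm tconorm
  for X :: "'a set"
    and M N :: "'a \<Rightarrow> 'a \<Rightarrow> real \<Rightarrow> real"
    and tnorm :: "real \<Rightarrow> real \<Rightarrow> real" (infixl "\<star>" 70)
    and tconorm :: "real \<Rightarrow> real \<Rightarrow> real" (infixl "\<diamondop>" 70) +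
  assumes nonempty: "X \<noteq> {}"
    and M_range: "\<lbrakk>x \<in> X; y \<in> X; t > 0\<rbrakk> \<Longrightarrow> M x y t \<in> {0..1}"
    and N_range: "\<lbrakk>x \<in> X; y \<in> X; t > 0\<rbrakk> \<Longrightarrow> N x y t \<in> {0..1}"
    and M_plus_N: "\<lbrakk>x \<in> X; y \<in> X; t > 0\<rbrakk> \<Longrightarrow> M x y t + N x y t \<le> 1"
    and M_pos: "\<lbrakk>x \<in> X; y \<in> X; t > 0\<rbrakk> \<Longrightarrow> M x y t > 0"
    and M_eq_1_iff: "\<lbrakk>x \<in> X; y \<in> X; t > 0\<rbrakk> \<Longrightarrow> M x y t = 1 \<longleftrightarrow> x = y"
    and M_sym: "\<lbrakk>x \<in> X; y \<in> X; t > 0\<rbrakk> \<Longrightarrow> M x y t = M y x t"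
    and M_triangle: "\<lbrakk>x \<in> X; y \<in> X; z \<in> X; t > 0; s > 0\<rbrakk>
                      \<Longrightarrow> M x y t \<star> M y z s \<le> M x z (t + s)"
    and M_continuous: "\<lbrakk>x \<in> X; y \<in> X\<rbrakk> \<Longrightarrow> continuous_on {0<..} (M x y)"
    and N_less_1: "\<lbrakk>x \<in> X; y \<in> X; t > 0\<rbrakk> \<Longrightarrow> N x y t < 1"
    and N_eq_0_iff: "\<lbrakk>x \<in> X; y \<in> X; t > 0\<rbrakk> \<Longrightarrow> N x y t = 0 \<longleftrightarrow> x = y"
    and N_sym: "\<lbrakk>x \<in> X; y \<in> X; t > 0\<rbrakk> \<Longrightarrow> N x y t = N y x t"
    and N_triangle: "\<lbrakk>x \<in> X; y \<in> X; z \<in> X; t > 0; s > 0\<rbrakk>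
                      \<Longrightarrow> N x y t \<diamondop> N y z s \<ge> N x z (t + s)"
    and N_continuous: "\<lbrakk>x \<in> X; y \<in> X\<rbrakk> \<Longrightarrow> continuous_on {0<..} (N x y)"

definition ifm_ball ::
  "'a set \<Rightarrow> ('a \<Rightarrow> 'a \<Rightarrow> real \<Rightarrow> real) \<Rightarrow> ('a \<Rightarrow> 'a \<Rightarrow> real \<Rightarrow> real) \<Rightarrow> 'a \<Rightarrow> real \<Rightarrow> real \<Rightarrow> 'a set"
  where "ifm_ball X M N x r t = {y \<in> X. M x y t > 1 - r \<and> N x y t < r}"

definition ifm_open ::
  "'a set \<Rightarrow> ('a \<Rightarrow> 'a \<Rightarrow> real \<Rightarrow> real) \<Rightarrow> ('a \<Rightarrow> 'a \<Rightarrow> real \<Rightarrow> real) \<Rightarrow> 'a set \<Rightarrow> bool"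
  where "ifm_open X M N U \<longleftrightarrow>
    U \<subseteq> X \<and> (\<forall>x\<in>U. \<exists>t>0. \<exists>r. 0 < r \<and> r < 1 \<and> ifm_ball X M N x r t \<subseteq> U)"

(* See openin_ifm_topology and topspace_ifm_topology below: for an intuitionistic fuzzy metric
   the open sets are exactly the ifm_open sets. *)
definition ifm_topology ::
  "'a set \<Rightarrow> ('a \<Rightarrow> 'a \<Rightarrow> real \<Rightarrow> real) \<Rightarrow> ('a \<Rightarrow> 'a \<Rightarrow> real \<Rightarrow> real) \<Rightarrow> 'a topology"
  where "ifm_topology X M N = topology (ifm_open X M N)"

definition ifm_converges ::
  "('a \<Rightarrow> 'a \<Rightarrow> real \<Rightarrow> real) \<Rightarrow> ('a \<Rightarrow> 'a \<Rightarrow> real \<Rightarrow> real) \<Rightarrow> (nat \<Rightarrow> 'a) \<Rightarrow> 'a \<Rightarrow> bool"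
  where "ifm_converges M N \<sigma> l \<longleftrightarrow>
    (\<forall>t>0. (\<lambda>n. M (\<sigma> n) l t) \<longlonglongrightarrow> 1 \<and> (\<lambda>n. N (\<sigma> n) l t) \<longlonglongrightarrow> 0)"

definition ifm_Cauchy ::
  "('a \<Rightarrow> 'a \<Rightarrow> real \<Rightarrow> real) \<Rightarrow> ('a \<Rightarrow> 'a \<Rightarrow> real \<Rightarrow> real) \<Rightarrow> (nat \<Rightarrow> 'a) \<Rightarrow> bool"
  where "ifm_Cauchy M N \<sigma> \<longleftrightarrow>
    (\<forall>\<epsilon> t. 0 < \<epsilon> \<and> \<epsilon> < 1 \<and> t > 0 \<longrightarrow>
      (\<exists>n0. \<forall>n\<ge>n0. \<forall>m\<ge>n0. M (\<sigma> n) (\<sigma> m) t > 1 - \<epsilon> \<and> N (\<sigma> n) (\<sigma> m) t < \<epsilon>))"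

definition ifm_complete ::
  "'a set \<Rightarrow> ('a \<Rightarrow> 'a \<Rightarrow> real \<Rightarrow> real) \<Rightarrow> ('a \<Rightarrow> 'a \<Rightarrow> real \<Rightarrow> real) \<Rightarrow> bool"
  where "ifm_complete X M N \<longleftrightarrow>
    (\<forall>\<sigma>. range \<sigma> \<subseteq> X \<and> ifm_Cauchy M N \<sigma> \<longrightarrow> (\<exists>l\<in>X. ifm_converges M N \<sigma> l))"

definition topologically_complete_ifm_metrizable :: "'a topology \<Rightarrow> bool"
  where "topologically_complete_ifm_metrizable \<tau> \<longleftrightarrow>
    (\<exists>M N tnorm tconorm.
      intuitionistic_fuzzy_metric_space (topspace \<tau>) M N tnorm tconorm \<and>
      ifm_complete (topspace \<tau>) M N \<and>
      ifm_topology (topspace \<tau>) M N = \<tau>)"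

context intuitionistic_fuzzy_metric_space
begin

lemma M_mono:
  assumes "x \<in> X" "y \<in> X" "0 < s" "s \<le> t"
  shows "M x y s \<le> M x y t"
proof (cases "s = t")
  case False
  then have p: "t - s > 0" using assms by simp
  have "M y y (t - s) = 1" using M_eq_1_iff assms p by blast
  then have "M x y s = M x y s \<star> M y y (t - s)"
    using tn.unit M_range assms by simp
  also have "\<dots> \<le> M x y (s + (t - s))" using M_triangle assms p by blast
  finally show ?thesis by simp
qed simp

lemma N_antimono:
  assumes "x \<in> X" "y \<in> X" "0 < s" "s \<le> t"
  shows "N x y t \<le> N x y s"
proof (cases "s = t")
  case False
  then have p: "t - s > 0" using assms by simp
  have "N y y (t - s) = 0" using N_eq_0_iff assms p by blast
  then have "N x y s = N x y s \<diamondop> N y y (t - s)"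
    using tc.unit N_range assms by simp
  also have "\<dots> \<ge> N x y (s + (t - s))" using N_triangle assms p by blast
  finally show ?thesis by simp
qed simp

lemma ifm_ball_mono:
  assumes "x \<in> X" "0 < s" "s \<le> t" "q \<le> r"
  shows "ifm_ball X M N x q s \<subseteq> ifm_ball X M N x r t"
  using M_mono[OF assms(1) _ assms(2,3)] N_antimono[OF assms(1) _ assms(2,3)] assms(4)
  by (force simp: ifm_ball_def)

lemma istopology_ifm_open: "istopology (ifm_open X M N)"
  unfolding istopology_def
proof (intro conjI allI impI)
  fix S T
  assume S: "ifm_open X M N S" and T: "ifm_open X M N T"
  show "ifm_open X M N (S \<inter> T)"
    unfolding ifm_open_def
  proof (intro conjI ballI)
    show "S \<inter> T \<subseteq> X" using S by (auto simp: ifm_open_def)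
    fix x assume x: "x \<in> S \<inter> T"
    then have xX: "x \<in> X" using S by (auto simp: ifm_open_def)
    obtain t r where 1: "t > 0" "0 < r" "r < 1" "ifm_ball X M N x r t \<subseteq> S"
      using S x unfolding ifm_open_def by blast
    obtain u q where 2: "u > 0" "0 < q" "q < 1" "ifm_ball X M N x q u \<subseteq> T"
      using T x unfolding ifm_open_def by blast
    have "ifm_ball X M N x (min r q) (min t u) \<subseteq> S \<inter> T"
      using ifm_ball_mono[OF xX, of "min t u" t "min r q" r]
        ifm_ball_mono[OF xX, of "min t u" u "min r q" q] 1 2 by auto
    then show "\<exists>t>0. \<exists>r. 0 < r \<and> r < 1 \<and> ifm_ball X M N x r t \<subseteq> S \<inter> T"
      using 1 2 by (intro exI[of _ "min t u"] conjI exI[of _ "min r q"]) auto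
  qed
next
  fix \<K> assume K: "\<forall>K\<in>\<K>. ifm_open X M N K"
  show "ifm_open X M N (\<Union>\<K>)"
    unfolding ifm_open_def
  proof (intro conjI ballI)
    show "\<Union>\<K> \<subseteq> X" using K by (auto simp: ifm_open_def)
    fix x assume "x \<in> \<Union>\<K>"
    then obtain K where k: "K \<in> \<K>" "x \<in> K" by blast
    then obtain t r where "t > 0" "0 < r" "r < 1" "ifm_ball X M N x r t \<subseteq> K"
      using K unfolding ifm_open_def by blast
    then show "\<exists>t>0. \<exists>r. 0 < r \<and> r < 1 \<and> ifm_ball X M N x r t \<subseteq> \<Union>\<K>"
      using k(1) by blast
  qed
qed

lemma openin_ifm_topology: "openin (ifm_topology X M N) U \<longleftrightarrow> ifm_open X M N U"
  by (simp add: ifm_topology_def istopology_ifm_open)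

lemma topspace_ifm_topology: "topspace (ifm_topology X M N) = X"
proof -
  have "ifm_open X M N X"
    unfolding ifm_open_def
  proof (intro conjI ballI subset_refl)
    fix x
    show "\<exists>t>0. \<exists>r. 0 < r \<and> r < 1 \<and> ifm_ball X M N x r t \<subseteq> X"
      by (intro exI[of _ 1] conjI exI[of _ "1/2"]) (auto simp: ifm_ball_def)
  qed
  then show ?thesis
    unfolding topspace_def openin_ifm_topology by (auto simp: ifm_open_def)
qed

end

end

theory Submission
  imports Defs
begin

text \<open>
  Continuity of the t-norm at (1,1) and of the t-conorm at (0,0) yields radii r(0), r(1), \<dots>
  tending to 0 such that three consecutive steps of size r(n+1), measured by (M,N), amount to one
  step of size r(n).  By Frink's metrization lemma the uniformity of an intuitionistic fuzzy metric
  therefore comes from an ordinary metric, with the same topology and the same Cauchy sequences.  A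
  complete space is thus completely metrizable, hence so is its \<open>G\<^sub>\<delta>\<close> subset A, and a complete
  metric d on A gives the complete intuitionistic fuzzy metric t/(t+d), d/(t+d) with min and max.
\<close>

section \<open>Frink's metrization lemma\<close>

text \<open>
  The induction cuts a chain of length S at the last point reached within S/2: both remaining
  pieces have length at most S/2, so the hypothesis bounds their end points by S, and so is the
  step in between.
\<close>

lemma quasimetric_chain_bound:
  fixes f :: "'a \<Rightarrow> 'a \<Rightarrow> real"
  assumes nonneg: "\<And>x y. 0 \<le> f x y"
    and refl: "\<And>x. f x x = 0"
    and quasi: "\<And>x y z w s. \<lbrakk>f x y \<le> s; f y z \<le> s; f z w \<le> s\<rbrakk> \<Longrightarrow> f x w \<le> 2 * s"
  shows "f (p 0) (p n) \<le> 2 * (\<Sum>i<n. f (p i) (p (Suc i)))"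
proof (induction n arbitrary: p rule: less_induct)
  case (less n)
  show ?case
  proof (cases n)
    case 0
    then show ?thesis by (simp add: refl)
  next
    case (Suc m)
    define S where "S = (\<lambda>j. \<Sum>i<j. f (p i) (p (Suc i)))"
    have S_mono: "S i \<le> S j" if "i \<le> j" for i j
      unfolding S_def using that by (intro sum_mono2) (auto simp: nonneg)
    define j where "j = (GREATEST j. j \<le> m \<and> 2 * S j \<le> S n)"
    have "S 0 = 0" by (simp add: S_def)
    then have ex: "0 \<le> m \<and> 2 * S 0 \<le> S n" using S_mono[of 0 n] by simp
    have j: "j \<le> m \<and> 2 * S j \<le> S n"
      unfolding j_def using ex by (rule GreatestI_nat[where b = m]) simp
    have jmax: "i \<le> j" if "i \<le> m" "2 * S i \<le> S n" for i
      unfolding j_def using that by (intro Greatest_le_nat[where b = m]) auto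
    have tail: "2 * (S n - S (Suc j)) \<le> S n"
    proof (cases "j = m")
      case True
      then show ?thesis using Suc S_mono[of 0 n] by (simp add: S_def)
    next
      case False
      then have "2 * S (Suc j) > S n" using jmax[of "Suc j"] j by force
      then show ?thesis by simp
    qed
    have split: "S (k + m) = S k + (\<Sum>i<m. f (p (k + i)) (p (k + Suc i)))" for k m
      unfolding S_def by (induction m) auto
    have "f (p 0) (p j) \<le> 2 * S j"
      unfolding S_def using less.IH[of j p] j Suc by simp
    then have "f (p 0) (p j) \<le> S n" using j by simp
    moreover have "f (p j) (p (Suc j)) \<le> S n"
      using S_mono[of "Suc j" n] S_mono[of 0 j] j Suc by (simp add: S_def)
    moreover have "f (p (Suc j)) (p n) \<le> S n"
    proof -
      have "f (p (Suc j + 0)) (p (Suc j + (n - Suc j)))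
          \<le> 2 * (\<Sum>i<n - Suc j. f (p (Suc j + i)) (p (Suc j + Suc i)))"
        using less.IH[of "n - Suc j" "\<lambda>i. p (Suc j + i)"] Suc by simp
      also have "\<dots> = 2 * (S n - S (Suc j))"
        using split[of "Suc j" "n - Suc j"] j Suc by simp
      finally show ?thesis using tail j Suc by simp
    qed
    ultimately show ?thesis
      using quasi[of "p 0" "p j" "S n" "p (Suc j)" "p n"] by (simp add: S_def)
  qed
qed

text \<open>The distance \<open>d\<close> is the infimum of the lengths of finite chains. A one-step
  chain gives \<open>d x y \<le> f x y\<close>, the chain bound gives
  \<open>f x y \<le> 2 * d x y\<close>, and concatenation of chains gives the triangle inequality
  that \<open>f\<close> itself may violate. The two-sided bound makes \<open>d\<close>
  definite.\<close>

lemma metric_equivalent_to_quasimetric: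
  fixes f :: "'a \<Rightarrow> 'a \<Rightarrow> real"
  assumes nonneg: "\<And>x y. 0 \<le> f x y"
    and sym: "\<And>x y. f x y = f y x"
    and zero: "\<And>x y. f x y = 0 \<longleftrightarrow> x = y"
    and quasi: "\<And>x y z w s. \<lbrakk>f x y \<le> s; f y z \<le> s; f z w \<le> s\<rbrakk> \<Longrightarrow> f x w \<le> 2 * s"
  obtains d where "Metric_space UNIV d" "\<And>x y. d x y \<le> f x y" "\<And>x y. f x y \<le> 2 * d x y"
proof -
  define L where "L = (\<lambda>p n. \<Sum>i<n. f (p i) (p (Suc i)))"
  define C where "C = (\<lambda>x y. {L p n | p n. p 0 = x \<and> p n = y})"
  define d where "d = (\<lambda>x y. Inf (C x y))"
  have L_nonneg: "0 \<le> L p n" for p n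
    unfolding L_def by (simp add: nonneg sum_nonneg)
  have bdd: "bdd_below (C x y)" for x y
    using L_nonneg by (auto simp: C_def intro!: bdd_belowI)
  have f_in: "f x y \<in> C x y" for x y
    unfolding C_def L_def
    by (intro CollectI exI[of _ "\<lambda>i. if i = 0 then x else y"] exI[of _ 1]) simp
  have upper: "d x y \<le> f x y" for x y
    unfolding d_def by (rule cInf_lower[OF f_in bdd])
  have lower: "f x y \<le> 2 * d x y" for x y
  proof -
    have "f x y / 2 \<le> Inf (C x y)"
    proof (rule cInf_greatest)
      fix c assume "c \<in> C x y"
      then obtain p n where "c = L p n" "p 0 = x" "p n = y" by (auto simp: C_def)
      moreover have "f (p 0) (p n) \<le> 2 * L p n"
        unfolding L_def by (rule quasimetric_chain_bound) (use nonneg zero quasi in blast)+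
      ultimately show "f x y / 2 \<le> c" by simp
    qed (use f_in in auto)
    then show ?thesis by (simp add: d_def)
  qed
  have C_sym: "C x y \<subseteq> C y x" for x y
  proof
    fix c assume "c \<in> C x y"
    then obtain p n where p: "c = L p n" "p 0 = x" "p n = y" by (auto simp: C_def)
    have "L p n = L (\<lambda>i. p (n - i)) n"
      unfolding L_def
      by (subst sum.nat_diff_reindex[symmetric]) (rule sum.cong, auto simp: sym Suc_diff_Suc)
    then show "c \<in> C y x" using p unfolding C_def by fastforce
  qed
  have triangle: "d x z \<le> d x y + d y z" for x y z
  proof -
    have join: "d x z \<le> a + b" if ab: "a \<in> C x y" "b \<in> C y z" for a b
    proof -
      obtain p n where p: "a = L p n" "p 0 = x" "p n = y" using ab by (auto simp: C_def)
      obtain q m where q: "b = L q m" "q 0 = y" "q m = z" using ab by (auto simp: C_def)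
      \<comment> \<open>The concatenated chain. The two pieces fit together at index
        \<open>n\<close>, since \<open>p n = y = q 0\<close>.\<close>
      define r where "r = (\<lambda>i. if i \<le> n then p i else q (i - n))"
      have r: "r (n + i) = q i" for i using p q by (auto simp: r_def)
      have "L r (n + m) = L r n + (\<Sum>i<m. f (r (n + i)) (r (n + Suc i)))"
        unfolding L_def by (induction m) auto
      also have "\<dots> = a + b"
        unfolding r p q L_def by (simp add: r_def)
      finally have "a + b \<in> C x z"
        unfolding C_def using r[of m] p q by (intro CollectI exI[of _ r] exI[of _ "n + m"]) (auto simp: r_def)
      then show ?thesis unfolding d_def using bdd by (rule cInf_lower)
    qed
    have ne: "C x y \<noteq> {}" for x y using f_in by blast
    \<comment> \<open>The infimum is taken first over the chains from \<open>x\<close> to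
      \<open>y\<close> with \<open>b\<close> fixed, then over \<open>b\<close>.\<close>
    have "d x z - b \<le> Inf (C x y)" if "b \<in> C y z" for b
      by (rule cInf_greatest[OF ne]) (use join[OF _ that] in \<open>simp add: diff_le_eq\<close>)
    then have "d x z - b \<le> d x y" if "b \<in> C y z" for b
      using that by (simp add: d_def)
    then have "d x z - d x y \<le> Inf (C y z)"
      by (intro cInf_greatest[OF ne]) (simp add: algebra_simps)
    then show ?thesis by (simp add: d_def)
  qed
  have "Metric_space UNIV d"
  proof
    show d0: "0 \<le> d x y" for x y using lower[of x y] nonneg[of x y] by simp
    show "d x y = d y x" for x y
      unfolding d_def using C_sym[of x y] C_sym[of y x] by simp
    show "d x y = 0 \<longleftrightarrow> x = y" for x y
      using lower[of x y] upper[of x y] d0[of x y] nonneg[of x y] zero[of x y] by auto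
  qed (rule triangle)
  then show thesis using upper lower that by blast
qed

text \<open>The function \<open>f\<close> is the power of 1/2 whose exponent is the first index at
  which \<open>V\<close> separates two points, so that \<open>f x y < (1/2) ^ n\<close> says exactly
  \<open>(x, y) \<in> V n\<close>. The threefold composition condition is then the quasimetric
  inequality. The factor 2 lost in passing from \<open>f\<close> to \<open>d\<close> is the shift to
  \<open>Suc n\<close> in the last conclusion.\<close>

lemma metric_of_entourages:
  fixes V :: "nat \<Rightarrow> ('a \<times> 'a) set"
  assumes sym: "\<And>n. sym (V n)"
    and comp: "\<And>n. V (Suc n) O V (Suc n) O V (Suc n) \<subseteq> V n"
    and Int: "(\<Inter>n. V n) = Id"
  obtains d where "Metric_space UNIV d"
    "\<And>n x y. (x, y) \<in> V n \<Longrightarrow> d x y < (1/2) ^ n"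
    "\<And>n x y. d x y < (1/2) ^ Suc n \<Longrightarrow> (x, y) \<in> V n"
proof -
  have refl: "(x, x) \<in> V n" for x n using Int by blast
  have "V (Suc n) \<subseteq> V n" for n
  proof
    fix z assume "z \<in> V (Suc n)"
    then have "(fst z, snd z) \<in> V (Suc n) O V (Suc n) O V (Suc n)"
      using refl[of _ "Suc n"] by (intro relcompI) auto
    then show "z \<in> V n" using comp[of n] by auto
  qed
  then have decr: "V n \<subseteq> V m" if "m \<le> n" for m n using that by (rule lift_Suc_antimono_le)
  \<comment> \<open>On the diagonal no \<open>V n\<close> separates, so \<open>l x x\<close> carries
    no information; \<open>f\<close> is set to 0 there separately.\<close>
  define l where "l = (\<lambda>x y. LEAST n. (x, y) \<notin> V n)"
  define f where "f = (\<lambda>x y. if x = y then 0 else (1/2::real) ^ l x y)"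
  have f_less: "f x y < (1/2) ^ n \<longleftrightarrow> (x, y) \<in> V n" for x y n
  proof (cases "x = y")
    case True
    then show ?thesis by (simp add: f_def refl)
  next
    case False
    then have "\<exists>n. (x, y) \<notin> V n" using Int by blast
    then have "(x, y) \<notin> V (l x y)" unfolding l_def by (rule LeastI_ex)
    moreover have "(x, y) \<in> V m" if "m < l x y" for m
      using that not_less_Least unfolding l_def by blast
    ultimately have "(x, y) \<in> V n \<longleftrightarrow> n < l x y" using decr by (meson not_le subsetD)
    then show ?thesis using False by (simp add: f_def power_strict_decreasing_iff)
  qed
  have nonneg: "0 \<le> f x y" and zero: "f x y = 0 \<longleftrightarrow> x = y" for x y by (auto simp: f_def)
  have fsym: "f x y = f y x" for x y
  proof -
    have "(x, y) \<in> V n \<longleftrightarrow> (y, x) \<in> V n" for n using sym[of n] by (meson symE)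
    then show ?thesis by (simp add: f_def l_def eq_commute)
  qed
  \<comment> \<open>If \<open>f x w\<close> exceeded \<open>2 * s\<close>, then \<open>s\<close>
    would lie below \<open>(1/2) ^ Suc (l x w)\<close>. All three steps would belong to
    \<open>V (Suc (l x w))\<close>, and their composition would put \<open>(x, w)\<close> into
    \<open>V (l x w)\<close>, against the choice of \<open>l x w\<close>.\<close>
  have quasi: "f x w \<le> 2 * s" if "f x y \<le> s" "f y z \<le> s" "f z w \<le> s" for x y z w s
  proof (rule ccontr)
    assume neg: "\<not> f x w \<le> 2 * s"
    have "0 \<le> s" using that(1) nonneg[of x y] by linarith
    then have "x \<noteq> w" using neg zero[of x w] by auto
    then have f: "f x w = (1/2) ^ l x w" by (simp add: f_def)
    then have "s < (1/2) ^ Suc (l x w)" using neg by simp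
    then have "(x, y) \<in> V (Suc (l x w))" "(y, z) \<in> V (Suc (l x w))" "(z, w) \<in> V (Suc (l x w))"
      using that by (auto simp flip: f_less)
    then have "(x, w) \<in> V (l x w)" using comp[of "l x w"] by blast
    then show False using f by (simp flip: f_less)
  qed
  obtain d where d: "Metric_space UNIV d" "\<And>x y. d x y \<le> f x y" "\<And>x y. f x y \<le> 2 * d x y"
    by (rule metric_equivalent_to_quasimetric[of f, OF nonneg fsym zero]) (use quasi in blast)+
  show thesis
  proof
    show "d x y < (1/2) ^ n" if "(x, y) \<in> V n" for n x y
      using that d(2)[of x y] by (simp flip: f_less)
    show "(x, y) \<in> V n" if "d x y < (1/2) ^ Suc n" for n x y
      using that d(3)[of x y] by (simp flip: f_less)
  qed (rule d(1))
qed

section \<open>From an intuitionistic fuzzy metric to an ordinary metric\<close>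

text \<open>The fixed point \<open>p\<close> is left general to serve both the t-norm at 1 and the
  t-conorm at 0. Continuity at \<open>(p, p)\<close> is used twice: for the outer application, and
  then, with the tolerance found there, for the inner one, whose value stays in the unit interval by
  \<open>closed\<close>.\<close>

lemma continuous_fixpoint_op_close:
  fixes h :: "real \<Rightarrow> real \<Rightarrow> real"
  assumes cont: "continuous_on ({0..1} \<times> {0..1}) (\<lambda>(a, b). h a b)"
    and closed: "\<And>a b. \<lbrakk>a \<in> {0..1}; b \<in> {0..1}\<rbrakk> \<Longrightarrow> h a b \<in> {0..1}"
    and p: "p \<in> {0..1}" "h p p = p" and e: "0 < e"
  obtains \<delta> where "0 < \<delta>"
    "\<And>a b c. \<lbrakk>a \<in> {0..1}; b \<in> {0..1}; c \<in> {0..1}; \<bar>a - p\<bar> < \<delta>; \<bar>b - p\<bar> < \<delta>; \<bar>c - p\<bar> < \<delta>\<rbrakk>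
      \<Longrightarrow> \<bar>h a (h b c) - p\<bar> < e"
proof -
  have two: "\<exists>\<delta>>0. \<forall>a\<in>{0..1}. \<forall>b\<in>{0..1}. \<bar>a - p\<bar> < \<delta> \<longrightarrow> \<bar>b - p\<bar> < \<delta> \<longrightarrow> \<bar>h a b - p\<bar> < e"
    if "0 < e" for e
  proof -
    obtain \<delta> where \<delta>: "\<delta> > 0" "\<And>z. \<lbrakk>z \<in> {0..1} \<times> {0..1}; dist z (p, p) < \<delta>\<rbrakk>
        \<Longrightarrow> dist (case z of (a, b) \<Rightarrow> h a b) (h p p) < e"
      using cont p \<open>0 < e\<close> unfolding continuous_on_iff by fastforce
    \<comment> \<open>Half of \<open>\<delta>\<close> per coordinate suffices, as the Euclidean
      distance is at most the sum of the coordinate distances.\<close>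
    have "dist (a, b) (p, p) < \<delta>" if "\<bar>a - p\<bar> < \<delta> / 2" "\<bar>b - p\<bar> < \<delta> / 2" for a b
      using that sqrt_sum_squares_le_sum_abs[of "a - p" "b - p"]
      by (simp add: dist_Pair_Pair dist_real_def)
    then show ?thesis
      using \<delta> p by (intro exI[of _ "\<delta> / 2"]) (force simp: dist_real_def)
  qed
  obtain \<delta>1 where 1: "\<delta>1 > 0" "\<And>a b. \<lbrakk>a \<in> {0..1}; b \<in> {0..1}; \<bar>a - p\<bar> < \<delta>1; \<bar>b - p\<bar> < \<delta>1\<rbrakk> \<Longrightarrow> \<bar>h a b - p\<bar> < e"
    using two[OF e] by blast
  obtain \<delta>2 where 2: "\<delta>2 > 0" "\<And>a b. \<lbrakk>a \<in> {0..1}; b \<in> {0..1}; \<bar>a - p\<bar> < \<delta>2; \<bar>b - p\<bar> < \<delta>2\<rbrakk> \<Longrightarrow> \<bar>h a b - p\<bar> < \<delta>1"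
    using two[OF 1(1)] by blast
  show thesis
    by (rule that[of "min \<delta>1 \<delta>2"]) (use 1 2 closed in auto)
qed

context intuitionistic_fuzzy_metric_space
begin

text \<open>This recasts convergence in the radii and times that define balls and Cauchy sequences,
  so that a single comparison of closeness relations handles all three. One-sided inequalities
  suffice because \<open>M\<close> never exceeds 1 and \<open>N\<close> is never negative.\<close>

lemma ifm_converges_iff:
  assumes "range \<sigma> \<subseteq> X" "l \<in> X"
  shows "ifm_converges M N \<sigma> l \<longleftrightarrow>
    (\<forall>r t. 0 < r \<and> r < 1 \<and> 0 < t \<longrightarrow> (\<forall>\<^sub>F n in sequentially. M (\<sigma> n) l t > 1 - r \<and> N (\<sigma> n) l t < r))"
    (is "_ \<longleftrightarrow> ?R")
proof
  assume c: "ifm_converges M N \<sigma> l"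
  show ?R
  proof (intro allI impI)
    fix r t :: real assume rt: "0 < r \<and> r < 1 \<and> 0 < t"
    then have "(\<lambda>n. M (\<sigma> n) l t) \<longlonglongrightarrow> 1" "(\<lambda>n. N (\<sigma> n) l t) \<longlonglongrightarrow> 0"
      using c by (auto simp: ifm_converges_def)
    then show "\<forall>\<^sub>F n in sequentially. M (\<sigma> n) l t > 1 - r \<and> N (\<sigma> n) l t < r"
      using rt by (intro eventually_conj order_tendstoD[where y = 1] order_tendstoD[where y = 0]) auto
  qed
next
  assume R: ?R
  have rng: "M (\<sigma> n) l t \<in> {0..1}" "N (\<sigma> n) l t \<in> {0..1}" if "0 < t" for n t
    using assms that M_range N_range by blast+
  show "ifm_converges M N \<sigma> l"
    unfolding ifm_converges_def
  proof (intro allI impI conjI)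
    fix t :: real assume t: "0 < t"
    have M_less: "M (\<sigma> n) l t < 1 + e" if "0 < e" for n e
      using rng(1)[OF t, of n] that by auto
    \<comment> \<open>The assumption covers only radii below 1, so a large \<open>e\<close> is first
      cut down to \<open>min e (1/2)\<close>.\<close>
    have ev: "\<forall>\<^sub>F n in sequentially. M (\<sigma> n) l t > 1 - e \<and> N (\<sigma> n) l t < e" if "0 < e" for e
    proof -
      have "\<forall>\<^sub>F n in sequentially. M (\<sigma> n) l t > 1 - min e (1/2) \<and> N (\<sigma> n) l t < min e (1/2)"
        using R t that by (auto simp: min_def)
      then show ?thesis by (rule eventually_mono) auto
    qed
    show "(\<lambda>n. M (\<sigma> n) l t) \<longlonglongrightarrow> 1"
    proof (rule tendstoI)
      fix e :: real assume "0 < e"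
      from ev[OF this] show "\<forall>\<^sub>F n in sequentially. dist (M (\<sigma> n) l t) 1 < e"
        by (rule eventually_mono) (use M_less[OF \<open>0 < e\<close>] in \<open>simp add: dist_real_def abs_less_iff algebra_simps\<close>)
    qed
    show "(\<lambda>n. N (\<sigma> n) l t) \<longlonglongrightarrow> 0"
    proof (rule tendstoI)
      fix e :: real assume "0 < e"
      from ev[OF this] show "\<forall>\<^sub>F n in sequentially. dist (N (\<sigma> n) l t) 0 < e"
        by (rule eventually_mono) (use rng[OF t] in \<open>auto simp: dist_real_def\<close>)
    qed
  qed
qed

text \<open>Together \<open>fine\<close> and \<open>coarse\<close> say that \<open>d\<close> and
  \<open>(M, N)\<close> generate the same uniformity on \<open>X\<close>; open sets, Cauchy
  sequences and limits depend only on the uniformity. The lemma serves both directions of the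
  argument: for the metric built by Frink's lemma, and for the fuzzy metric built from an ordinary
  metric.\<close>

lemma uniformly_equivalent_metric:
  assumes "Metric_space X d"
    and fine: "\<And>e. 0 < e \<Longrightarrow> \<exists>r t. 0 < r \<and> r < 1 \<and> 0 < t \<and>
      (\<forall>x\<in>X. \<forall>y\<in>X. M x y t > 1 - r \<and> N x y t < r \<longrightarrow> d x y < e)"
    and coarse: "\<And>r t. \<lbrakk>0 < r; r < 1; 0 < t\<rbrakk> \<Longrightarrow> \<exists>e>0.
      \<forall>x\<in>X. \<forall>y\<in>X. d x y < e \<longrightarrow> M x y t > 1 - r \<and> N x y t < r"
  shows "ifm_topology X M N = Metric_space.mtopology X d"
    and "ifm_complete X M N \<longleftrightarrow> Metric_space.mcomplete X d"
proof -
  interpret m: Metric_space X d by fact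
  show "ifm_topology X M N = m.mtopology"
  proof (rule topology_eq[THEN iffD2], intro allI)
    fix U
    have "(\<exists>t>0. \<exists>r. 0 < r \<and> r < 1 \<and> ifm_ball X M N x r t \<subseteq> U) \<longleftrightarrow> (\<exists>e>0. m.mball x e \<subseteq> U)"
      (is "?L \<longleftrightarrow> ?R") if x: "x \<in> X" for x
    proof
      assume ?L
      then obtain t r where t: "t > 0" "0 < r" "r < 1" and sub: "ifm_ball X M N x r t \<subseteq> U" by blast
      obtain e where "e > 0" "m.mball x e \<subseteq> ifm_ball X M N x r t"
        using coarse[OF t(2,3,1)] x unfolding ifm_ball_def by force
      then show ?R using sub by blast
    next
      assume ?R
      then obtain e where e: "e > 0" and sub: "m.mball x e \<subseteq> U" by blast
      obtain r t where "0 < r" "r < 1" "0 < t" "ifm_ball X M N x r t \<subseteq> m.mball x e"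
        using fine[OF e] x unfolding ifm_ball_def by force
      then show ?L using sub by blast
    qed
    then show "openin (ifm_topology X M N) U \<longleftrightarrow> openin m.mtopology U"
      unfolding openin_ifm_topology m.openin_mtopology ifm_open_def by blast
  qed
  have cauchy: "m.MCauchy \<sigma> \<longleftrightarrow> ifm_Cauchy M N \<sigma>" if \<sigma>: "range \<sigma> \<subseteq> X" for \<sigma>
  proof
    assume c: "m.MCauchy \<sigma>"
    show "ifm_Cauchy M N \<sigma>"
      unfolding ifm_Cauchy_def
    proof (intro allI impI)
      fix r t :: real assume "0 < r \<and> r < 1 \<and> t > 0"
      then obtain e where "e > 0"
        and e: "\<forall>x\<in>X. \<forall>y\<in>X. d x y < e \<longrightarrow> M x y t > 1 - r \<and> N x y t < r"
        using coarse by blast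
      then obtain k where "\<forall>n n'. k \<le> n \<longrightarrow> k \<le> n' \<longrightarrow> d (\<sigma> n) (\<sigma> n') < e"
        using c unfolding m.MCauchy_def by blast
      then show "\<exists>n0. \<forall>n\<ge>n0. \<forall>m\<ge>n0. M (\<sigma> n) (\<sigma> m) t > 1 - r \<and> N (\<sigma> n) (\<sigma> m) t < r"
        using e \<sigma> by (intro exI[of _ k]) blast
    qed
  next
    assume c: "ifm_Cauchy M N \<sigma>"
    show "m.MCauchy \<sigma>"
      unfolding m.MCauchy_def
    proof (intro conjI \<sigma> allI impI)
      fix e :: real assume "0 < e"
      then obtain r t where rt: "0 < r" "r < 1" "0 < t"
        and e: "\<forall>x\<in>X. \<forall>y\<in>X. M x y t > 1 - r \<and> N x y t < r \<longrightarrow> d x y < e"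
        using fine by blast
      then obtain k where "\<forall>n\<ge>k. \<forall>m\<ge>k. M (\<sigma> n) (\<sigma> m) t > 1 - r \<and> N (\<sigma> n) (\<sigma> m) t < r"
        using c unfolding ifm_Cauchy_def by blast
      then show "\<exists>k. \<forall>n n'. k \<le> n \<longrightarrow> k \<le> n' \<longrightarrow> d (\<sigma> n) (\<sigma> n') < e"
        using e \<sigma> by (intro exI[of _ k]) blast
    qed
  qed
  have conv: "limitin m.mtopology \<sigma> l sequentially \<longleftrightarrow> ifm_converges M N \<sigma> l"
    if \<sigma>: "range \<sigma> \<subseteq> X" and l: "l \<in> X" for \<sigma> l
  proof -
    have in_X: "\<sigma> n \<in> X" for n using \<sigma> by blast
    show ?thesis
      unfolding ifm_converges_iff[OF \<sigma> l] m.limitin_metric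
    proof (intro iffI conjI allI impI l)
      fix r t :: real
      assume lim: "l \<in> X \<and> (\<forall>e>0. \<forall>\<^sub>F n in sequentially. \<sigma> n \<in> X \<and> d (\<sigma> n) l < e)"
        and "0 < r \<and> r < 1 \<and> 0 < t"
      then obtain e where e: "e > 0"
        "\<forall>x\<in>X. \<forall>y\<in>X. d x y < e \<longrightarrow> M x y t > 1 - r \<and> N x y t < r"
        using coarse by blast
      from lim e(1) have "\<forall>\<^sub>F n in sequentially. \<sigma> n \<in> X \<and> d (\<sigma> n) l < e" by blast
      then show "\<forall>\<^sub>F n in sequentially. M (\<sigma> n) l t > 1 - r \<and> N (\<sigma> n) l t < r"
        by (rule eventually_mono) (use e(2) l in blast)
    next
      fix e :: real
      assume lim: "\<forall>r t. 0 < r \<and> r < 1 \<and> 0 < t \<longrightarrow>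
          (\<forall>\<^sub>F n in sequentially. M (\<sigma> n) l t > 1 - r \<and> N (\<sigma> n) l t < r)"
        and "0 < e"
      then obtain r t where rt: "0 < r" "r < 1" "0 < t"
        and e: "\<forall>x\<in>X. \<forall>y\<in>X. M x y t > 1 - r \<and> N x y t < r \<longrightarrow> d x y < e"
        using fine by blast
      from lim rt have "\<forall>\<^sub>F n in sequentially. M (\<sigma> n) l t > 1 - r \<and> N (\<sigma> n) l t < r" by blast
      then show "\<forall>\<^sub>F n in sequentially. \<sigma> n \<in> X \<and> d (\<sigma> n) l < e"
        by (rule eventually_mono) (use e in_X l in blast)
    qed
  qed
  show "ifm_complete X M N \<longleftrightarrow> m.mcomplete"
    unfolding ifm_complete_def m.mcomplete_def
    using cauchy conv m.MCauchy_def m.limitin_mspace by metis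
qed

text \<open>The number \<open>\<delta>\<close> acts as radius and as time. As a radius it comes from
  continuity of the operations at their units. As a time it is at most \<open>e / 3\<close>, so that
  three steps take time at most \<open>e\<close> and monotonicity in time finishes the
  estimate.\<close>

lemma triple_radius:
  assumes "0 < e" "e < 1"
  obtains \<delta> where "0 < \<delta>" "\<delta> \<le> e / 3"
    "\<And>x y z w. \<lbrakk>x \<in> X; y \<in> X; z \<in> X; w \<in> X;
        M x y \<delta> > 1 - \<delta>; M y z \<delta> > 1 - \<delta>; M z w \<delta> > 1 - \<delta>;
        N x y \<delta> < \<delta>; N y z \<delta> < \<delta>; N z w \<delta> < \<delta>\<rbrakk> \<Longrightarrow> M x w e > 1 - e \<and> N x w e < e"
proof -
  obtain \<delta>1 where "0 < \<delta>1" and 1: "\<And>a b c. \<lbrakk>a \<in> {0..1}; b \<in> {0..1}; c \<in> {0..1};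
      \<bar>a - 1\<bar> < \<delta>1; \<bar>b - 1\<bar> < \<delta>1; \<bar>c - 1\<bar> < \<delta>1\<rbrakk> \<Longrightarrow> \<bar>a \<star> (b \<star> c) - 1\<bar> < e"
    using continuous_fixpoint_op_close[OF tn.continuous tn.closed _ _ assms(1), of 1] tn.unit by auto
  obtain \<delta>2 where "0 < \<delta>2" and 2: "\<And>a b c. \<lbrakk>a \<in> {0..1}; b \<in> {0..1}; c \<in> {0..1};
      \<bar>a - 0\<bar> < \<delta>2; \<bar>b - 0\<bar> < \<delta>2; \<bar>c - 0\<bar> < \<delta>2\<rbrakk> \<Longrightarrow> \<bar>a \<diamondop> (b \<diamondop> c) - 0\<bar> < e"
    using continuous_fixpoint_op_close[OF tc.continuous tc.closed _ _ assms(1), of 0] tc.unit by auto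
  define \<delta> where "\<delta> = min (e / 3) (min \<delta>1 \<delta>2)"
  have \<delta>: "0 < \<delta>" "\<delta> \<le> e / 3" "\<delta> \<le> \<delta>1" "\<delta> \<le> \<delta>2"
    using assms \<open>0 < \<delta>1\<close> \<open>0 < \<delta>2\<close> by (auto simp: \<delta>_def)
  show thesis
  proof (rule that[OF \<delta>(1,2)])
    fix x y z w
    assume X: "x \<in> X" "y \<in> X" "z \<in> X" "w \<in> X"
      and Mb: "M x y \<delta> > 1 - \<delta>" "M y z \<delta> > 1 - \<delta>" "M z w \<delta> > 1 - \<delta>"
      and Nb: "N x y \<delta> < \<delta>" "N y z \<delta> < \<delta>" "N z w \<delta> < \<delta>"
    have Mr: "M x y \<delta> \<in> {0..1}" "M y z \<delta> \<in> {0..1}" "M z w \<delta> \<in> {0..1}" "M y w (\<delta> + \<delta>) \<in> {0..1}"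
      and Nr: "N x y \<delta> \<in> {0..1}" "N y z \<delta> \<in> {0..1}" "N z w \<delta> \<in> {0..1}" "N y w (\<delta> + \<delta>) \<in> {0..1}"
      using X \<delta>(1) M_range N_range by simp_all
    have le: "\<delta> + (\<delta> + \<delta>) \<le> e" using \<delta>(2) by simp
    have "M x y \<delta> \<star> (M y z \<delta> \<star> M z w \<delta>) \<le> M x y \<delta> \<star> M y w (\<delta> + \<delta>)"
      using X \<delta>(1) Mr by (intro tn.mono tn.closed M_triangle) auto
    also have "\<dots> \<le> M x w (\<delta> + (\<delta> + \<delta>))" using X \<delta>(1) by (intro M_triangle) auto
    also have "\<dots> \<le> M x w e" using X \<delta>(1) le by (intro M_mono) auto
    finally have M: "M x y \<delta> \<star> (M y z \<delta> \<star> M z w \<delta>) \<le> M x w e" .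
    have "N x w e \<le> N x w (\<delta> + (\<delta> + \<delta>))" using X \<delta>(1) le by (intro N_antimono) auto
    also have "\<dots> \<le> N x y \<delta> \<diamondop> N y w (\<delta> + \<delta>)" using X \<delta>(1) by (intro N_triangle) auto
    also have "\<dots> \<le> N x y \<delta> \<diamondop> (N y z \<delta> \<diamondop> N z w \<delta>)"
      using X \<delta>(1) Nr by (intro tc.mono tc.closed N_triangle) auto
    finally have N: "N x w e \<le> N x y \<delta> \<diamondop> (N y z \<delta> \<diamondop> N z w \<delta>)" .
    have "\<bar>M x y \<delta> \<star> (M y z \<delta> \<star> M z w \<delta>) - 1\<bar> < e"
      by (rule 1) (use Mr Mb \<delta> in auto)
    moreover have "\<bar>N x y \<delta> \<diamondop> (N y z \<delta> \<diamondop> N z w \<delta>) - 0\<bar> < e"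
      by (rule 2) (use Nr Nb \<delta> in auto)
    ultimately show "M x w e > 1 - e \<and> N x w e < e" using M N by linarith
  qed
qed

text \<open>Iterating \<open>triple_radius\<close> gives a sequence of entourages to which
  \<open>metric_of_entourages\<close> applies. Its radii tend to 0, so the sequence is cofinal among
  all pairs of a radius and a time, which yields \<open>fine\<close> and
  \<open>coarse\<close>.\<close>

lemma uniformly_equivalent_metric_exists:
  obtains d where "Metric_space X d"
    "ifm_topology X M N = Metric_space.mtopology X d"
    "ifm_complete X M N \<longleftrightarrow> Metric_space.mcomplete X d"
proof -
  \<comment> \<open>Using one number as both radius and time reduces the two-parameter family of
    closeness relations to a sequence.\<close>
  define close where "close = (\<lambda>r x y. M x y r > 1 - r \<and> N x y r < r)"
  have "\<exists>\<epsilon>. \<forall>n. (0 < \<epsilon> n \<and> \<epsilon> n < 1) \<and> (\<epsilon> (Suc n) \<le> \<epsilon> n / 3 \<and>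
      (\<forall>x\<in>X. \<forall>y\<in>X. \<forall>z\<in>X. \<forall>w\<in>X. close (\<epsilon> (Suc n)) x y \<longrightarrow> close (\<epsilon> (Suc n)) y z \<longrightarrow>
        close (\<epsilon> (Suc n)) z w \<longrightarrow> close (\<epsilon> n) x w))"
  proof (rule dependent_nat_choice)
    show "\<exists>e::real. 0 < e \<and> e < 1" by (rule exI[of _ "1/2"]) simp
    fix e :: real and n :: nat
    assume e: "0 < e \<and> e < 1"
    then obtain \<delta> where "0 < \<delta>" "\<delta> \<le> e / 3" and
      "\<And>x y z w. \<lbrakk>x \<in> X; y \<in> X; z \<in> X; w \<in> X;
        M x y \<delta> > 1 - \<delta>; M y z \<delta> > 1 - \<delta>; M z w \<delta> > 1 - \<delta>;
        N x y \<delta> < \<delta>; N y z \<delta> < \<delta>; N z w \<delta> < \<delta>\<rbrakk> \<Longrightarrow> M x w e > 1 - e \<and> N x w e < e"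
      using triple_radius[of e] by metis
    then show "\<exists>\<delta>. (0 < \<delta> \<and> \<delta> < 1) \<and> \<delta> \<le> e / 3 \<and>
      (\<forall>x\<in>X. \<forall>y\<in>X. \<forall>z\<in>X. \<forall>w\<in>X. close \<delta> x y \<longrightarrow> close \<delta> y z \<longrightarrow> close \<delta> z w \<longrightarrow> close e x w)"
      using e unfolding close_def by (intro exI[of _ \<delta>]) auto
  qed
  then obtain \<epsilon> where pos: "\<And>n. 0 < \<epsilon> n" and less1: "\<And>n. \<epsilon> n < 1"
    and step: "\<And>n. \<epsilon> (Suc n) \<le> \<epsilon> n / 3"
    and comp: "\<And>n x y z w. \<lbrakk>x \<in> X; y \<in> X; z \<in> X; w \<in> X; close (\<epsilon> (Suc n)) x y;
      close (\<epsilon> (Suc n)) y z; close (\<epsilon> (Suc n)) z w\<rbrakk> \<Longrightarrow> close (\<epsilon> n) x w"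
    by metis
  have bound: "\<epsilon> n \<le> (1/3) ^ n" for n
  proof (induction n)
    case (Suc n)
    then show ?case using step[of n] by simp
  qed (use less1[of 0] in simp)
  then have small: "\<exists>n. \<epsilon> n < e" if e: "0 < e" for e
  proof -
    obtain n where "(1/3) ^ n < e" using real_arch_pow_inv[OF e, of "1/3"] by auto
    with bound show ?thesis by (meson le_less_trans)
  qed
  have close_refl: "close (\<epsilon> n) x x" if "x \<in> X" for n x
    using that pos[of n] M_eq_1_iff[of x x "\<epsilon> n"] N_eq_0_iff[of x x "\<epsilon> n"] by (simp add: close_def)
  have close_mono: "M x y t > 1 - r \<and> N x y t < r"
    if "close (\<epsilon> n) x y" "x \<in> X" "y \<in> X" "\<epsilon> n < r" "\<epsilon> n < t" for n x y r t
    using that M_mono[of x y "\<epsilon> n" t] N_antimono[of x y "\<epsilon> n" t] pos[of n] by (auto simp: close_def)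
  \<comment> \<open>\<open>metric_of_entourages\<close> works on the whole type, so the diagonal is
    added to cover points outside \<open>X\<close>; the resulting metric is restricted to
    \<open>X\<close> afterwards.\<close>
  define V where "V = (\<lambda>n. {(x, y). x \<in> X \<and> y \<in> X \<and> close (\<epsilon> n) x y} \<union> Id)"
  have V_X: "(x, y) \<in> V n \<longleftrightarrow> close (\<epsilon> n) x y" if "x \<in> X" "y \<in> X" for x y n
    using that close_refl by (auto simp: V_def)
  have "sym (V n)" for n
    using M_sym N_sym pos by (auto simp: V_def sym_def close_def)
  moreover have "V (Suc n) O V (Suc n) O V (Suc n) \<subseteq> V n" for n
    unfolding V_def using comp close_refl by blast
  moreover have "(\<Inter>n. V n) = Id"
  proof (intro equalityI subsetI)
    fix z assume z: "z \<in> (\<Inter>n. V n)"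
    obtain x y where xy: "z = (x, y)" by (cases z)
    show "z \<in> Id"
    proof (rule ccontr)
      assume "z \<notin> Id"
      then have ne: "x \<noteq> y" using xy by simp
      then have X: "x \<in> X" "y \<in> X" and cl: "\<And>n. close (\<epsilon> n) x y"
        using z unfolding xy V_def by auto
      \<comment> \<open>Distinct points are separated already at time 1: with
        \<open>\<epsilon> n\<close> below \<open>1 - M x y 1\<close>, closeness would give
        \<open>M x y 1 > M x y 1\<close>.\<close>
      have "M x y 1 < 1" using ne X M_eq_1_iff[of x y 1] M_range[of x y 1] by fastforce
      then obtain n where "\<epsilon> n < 1 - M x y 1" using small[of "1 - M x y 1"] by auto
      then show False using close_mono[OF cl[of n] X _ less1[of n], of "1 - M x y 1"] by simp
    qed
  qed (auto simp: V_def)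
  ultimately obtain d where d: "Metric_space UNIV d"
    "\<And>n x y. (x, y) \<in> V n \<Longrightarrow> d x y < (1/2) ^ n"
    "\<And>n x y. d x y < (1/2) ^ Suc n \<Longrightarrow> (x, y) \<in> V n"
    using metric_of_entourages by metis
  have dX: "Metric_space X d" using Metric_space.subspace[OF d(1)] by simp
  have fine: "\<exists>r t. 0 < r \<and> r < 1 \<and> 0 < t \<and>
      (\<forall>x\<in>X. \<forall>y\<in>X. M x y t > 1 - r \<and> N x y t < r \<longrightarrow> d x y < e)" if e: "0 < e" for e
  proof -
    obtain n where n: "(1/2) ^ n < e" using real_arch_pow_inv[OF e, of "1/2"] by auto
    have "d x y < e" if "x \<in> X" "y \<in> X" "M x y (\<epsilon> n) > 1 - \<epsilon> n" "N x y (\<epsilon> n) < \<epsilon> n" for x y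
      using that d(2)[of x y n] V_X n by (fastforce simp: close_def)
    then show ?thesis using pos less1 by (intro exI[of _ "\<epsilon> n"]) auto
  qed
  have coarse: "\<exists>e>0. \<forall>x\<in>X. \<forall>y\<in>X. d x y < e \<longrightarrow> M x y t > 1 - r \<and> N x y t < r"
    if rt: "0 < r" "r < 1" "0 < t" for r t
  proof -
    obtain n where n: "\<epsilon> n < min r t" using small[of "min r t"] rt by auto
    have "M x y t > 1 - r \<and> N x y t < r" if "x \<in> X" "y \<in> X" "d x y < (1/2) ^ Suc n" for x y
      using close_mono[of n x y r t] V_X d(3)[OF that(3)] that n by simp
    then show ?thesis by (intro exI[of _ "(1/2) ^ Suc n"]) simp
  qed
  show thesis
    by (rule that[OF dX uniformly_equivalent_metric[OF dX fine coarse]])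
qed

end

section \<open>From an ordinary metric to an intuitionistic fuzzy metric\<close>

context Metric_space
begin

text \<open>Here \<open>M\<close> is the carrier of the metric space. For the triangle inequality
  let \<open>m\<close> be the smaller of the two fractions: then
  \<open>m * (t + d x y) \<le> t\<close> and \<open>m * (s + d y z) \<le> s\<close>, and adding
  these bounds \<open>m * (t + s + d x z)\<close> by \<open>t + s\<close>. The second fraction is 1
  minus the first, which turns the inequality for \<open>min\<close> into the one for
  \<open>max\<close>.\<close>

lemma standard_intuitionistic_fuzzy_metric_space:
  assumes "M \<noteq> {}"
  shows "intuitionistic_fuzzy_metric_space M
    (\<lambda>x y t. t / (t + d x y)) (\<lambda>x y t. d x y / (t + d x y)) min max"
proof -
  have frac: "min (t / (t + d x y)) (s / (s + d y z)) \<le> (t + s) / (t + s + d x z)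
      \<and> d x z / (t + s + d x z) \<le> max (d x y / (t + d x y)) (d y z / (s + d y z))"
    if "x \<in> M" "y \<in> M" "z \<in> M" "0 < t" "0 < s" for x y z and t s :: real
  proof -
    let ?m = "min (t / (t + d x y)) (s / (s + d y z))"
    have p: "0 < t + d x y" "0 < s + d y z" "0 < t + s + d x z"
      using that by (auto intro: add_pos_nonneg)
    have m0: "0 \<le> ?m" using that by auto
    have "?m * (t + d x y) \<le> t" "?m * (s + d y z) \<le> s"
      using p by (auto simp: min_le_iff_disj simp flip: pos_le_divide_eq)
    moreover have "?m * (t + s + d x z) \<le> ?m * (t + d x y) + ?m * (s + d y z)"
      using mult_left_mono[OF triangle[OF that(1-3)] m0] by (simp add: algebra_simps)
    ultimately have 1: "?m \<le> (t + s) / (t + s + d x z)"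
      using p(3) by (simp add: pos_le_divide_eq)
    have "d x z / (t + s + d x z) = 1 - (t + s) / (t + s + d x z)"
      "d x y / (t + d x y) = 1 - t / (t + d x y)" "d y z / (s + d y z) = 1 - s / (s + d y z)"
      using p by (simp_all add: field_simps)
    then show ?thesis using 1 by (auto simp: min_def max_def split: if_splits)
  qed
  have pos: "0 < t + d x y" if "0 < t" for t :: real and x y using that by (simp add: add_pos_nonneg)
  have nonzero: "t + d x y \<noteq> 0" if "0 < t" for t :: real and x y using pos[OF that, of x y] by simp
  have complement: "d x y / (t + d x y) = 1 - t / (t + d x y)" if "0 < t" for t :: real and x y
    using nonzero[OF that, of x y] by (simp add: field_simps)
  have range: "t / (t + d x y) \<in> {0<..1}" if "0 < t" for t :: real and x y
    using pos[OF that, of x y] that by simp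
  show ?thesis
  proof
    show "continuous_on ({0..1} \<times> {0..1}) (\<lambda>(a, b). min a (b::real))"
      "continuous_on ({0..1} \<times> {0..1}) (\<lambda>(a, b). max a (b::real))"
      unfolding case_prod_beta by (intro continuous_intros)+
    show "continuous_on {0<..} (\<lambda>t. t / (t + d x y))"
      "continuous_on {0<..} (\<lambda>t. d x y / (t + d x y))" for x y
      by (intro continuous_intros; use nonzero in simp)+
  next
    fix x y z and t s :: real assume "x \<in> M" "y \<in> M" "z \<in> M" "0 < t" "0 < s"
    then show "min (t / (t + d x y)) (s / (s + d y z)) \<le> (t + s) / (t + s + d x z)"
      "d x z / (t + s + d x z) \<le> max (d x y / (t + d x y)) (d y z / (s + d y z))"
      using frac by blast+
  next
    fix x y and t :: real assume xy: "x \<in> M" "y \<in> M" and t: "0 < t"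
    show "t / (t + d x y) \<in> {0..1}" "d x y / (t + d x y) \<in> {0..1}"
      "t / (t + d x y) + d x y / (t + d x y) \<le> 1" "0 < t / (t + d x y)" "d x y / (t + d x y) < 1"
      using range[OF t, of x y] complement[OF t, of x y] by auto
    show "t / (t + d x y) = 1 \<longleftrightarrow> x = y" "d x y / (t + d x y) = 0 \<longleftrightarrow> x = y"
      using nonzero[OF t, of x y] zero[OF xy] by auto
    show "t / (t + d x y) = t / (t + d y x)" "d x y / (t + d x y) = d y x / (t + d y x)"
      by (simp_all add: commute)
  qed (use assms in auto)
qed

lemma standard_intuitionistic_fuzzy_metric_equivalent:
  assumes "M \<noteq> {}"
  shows "ifm_topology M (\<lambda>x y t. t / (t + d x y)) (\<lambda>x y t. d x y / (t + d x y)) = mtopology"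
    and "ifm_complete M (\<lambda>x y t. t / (t + d x y)) (\<lambda>x y t. d x y / (t + d x y)) \<longleftrightarrow> mcomplete"
proof -
  interpret s: intuitionistic_fuzzy_metric_space M
    "\<lambda>x y t. t / (t + d x y)" "\<lambda>x y t. d x y / (t + d x y)" min max
    using assms by (rule standard_intuitionistic_fuzzy_metric_space)
  have pos: "0 < t + d x y" if "0 < t" for t x y using that by (simp add: add_pos_nonneg)
  have fine: "\<exists>r t. 0 < r \<and> r < 1 \<and> 0 < t \<and> (\<forall>x\<in>M. \<forall>y\<in>M.
      t / (t + d x y) > 1 - r \<and> d x y / (t + d x y) < r \<longrightarrow> d x y < e)" if "0 < e" for e :: real
  proof -
    \<comment> \<open>The radius \<open>e / (1 + e)\<close> at time 1 is the value at
      \<open>e\<close> of the increasing function \<open>u / (1 + u)\<close>.\<close>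
    have "d x y < e" if "d x y / (1 + d x y) < e / (1 + e)" for x y
      using that pos[of 1 x y] \<open>0 < e\<close> by (simp add: divide_simps algebra_simps)
    then show ?thesis
      using that by (intro exI[of _ "e / (1 + e)"] exI[of _ 1]) auto
  qed
  have coarse: "\<exists>e>0. \<forall>x\<in>M. \<forall>y\<in>M. d x y < e \<longrightarrow>
      t / (t + d x y) > 1 - r \<and> d x y / (t + d x y) < r" if "0 < r" "r < 1" "0 < t" for r t
  proof -
    have "t / (t + d x y) > 1 - r \<and> d x y / (t + d x y) < r" if "d x y < r * t" for x y
    proof -
      \<comment> \<open>Enlarging \<open>r * t\<close> to \<open>r * (t + d x y)\<close> gives both
        required inequalities at once, since the two fractions sum to 1.\<close>
      have "0 \<le> r * d x y" using \<open>0 < r\<close> by simp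
      then have "d x y < r * (t + d x y)" using that by (simp add: algebra_simps)
      then show ?thesis using pos[OF \<open>0 < t\<close>, of x y] by (simp add: field_simps)
    qed
    then show ?thesis using that by (intro exI[of _ "r * t"]) auto
  qed
  show "ifm_topology M (\<lambda>x y t. t / (t + d x y)) (\<lambda>x y t. d x y / (t + d x y)) = mtopology"
    and "ifm_complete M (\<lambda>x y t. t / (t + d x y)) (\<lambda>x y t. d x y / (t + d x y)) \<longleftrightarrow> mcomplete"
    by (rule s.uniformly_equivalent_metric[OF Metric_space_axioms fine coarse]; assumption)+
qed

end

section \<open>Complete metrizability and the passage to the subset\<close>

lemma completely_metrizable_imp_topologically_complete_ifm_metrizable:
  assumes "completely_metrizable_space \<tau>" "topspace \<tau> \<noteq> {}"
  shows "topologically_complete_ifm_metrizable \<tau>"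
proof -
  obtain S d where "Metric_space S d" and d: "Metric_space.mcomplete S d"
    and \<tau>: "\<tau> = Metric_space.mtopology S d"
    using assms(1) unfolding completely_metrizable_space_def by blast
  interpret Metric_space S d by fact
  have S: "topspace \<tau> = S" by (simp add: \<tau>)
  then have "S \<noteq> {}" using assms(2) by simp
  show ?thesis
    unfolding topologically_complete_ifm_metrizable_def S
    using standard_intuitionistic_fuzzy_metric_space[OF \<open>S \<noteq> {}\<close>] d \<tau>
      standard_intuitionistic_fuzzy_metric_equivalent[OF \<open>S \<noteq> {}\<close>] by blast
qed

theorem corollary3p7:
  fixes X A :: "'a set"
    and M N :: "'a \<Rightarrow> 'a \<Rightarrow> real \<Rightarrow> real"
    and tnorm tconorm :: "real \<Rightarrow> real \<Rightarrow> real"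
  assumes "intuitionistic_fuzzy_metric_space X M N tnorm tconorm"
    and "ifm_complete X M N"
    and "A \<subseteq> X"
    and "A \<noteq> {}"
    and "gdelta_in (ifm_topology X M N) A"
  shows "topologically_complete_ifm_metrizable (subtopology (ifm_topology X M N) A)"
proof (rule completely_metrizable_imp_topologically_complete_ifm_metrizable)
  interpret intuitionistic_fuzzy_metric_space X M N tnorm tconorm by fact
  have "completely_metrizable_space (ifm_topology X M N)"
    unfolding completely_metrizable_space_def
    by (rule uniformly_equivalent_metric_exists) (use assms(2) in blast)
  \<comment> \<open>By Alexandrov's theorem complete metrizability passes to
    \<open>G\<^sub>\<delta>\<close> subsets. The restricted metric need not be complete on
    \<open>A\<close>, so this is a statement about the topology.\<close>
  then show "completely_metrizable_space (subtopology (ifm_topology X M N) A)"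
    using assms(5) by (rule completely_metrizable_space_gdelta_in)
  show "topspace (subtopology (ifm_topology X M N) A) \<noteq> {}"
    using assms(3,4) by (simp add: topspace_ifm_topology inf_absorb2)
qed

end
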